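(* For any numbers $k$ of experts and $n$ of rounds, and for binary independent stationary distributions $\mathcal{F}^{\mathrm{BIS}}$, the follow-the-leader algorithm $M^{\mathrm{FTL}}$ is the prior-independent optimal online learning algorithm; i.e. $M^{\mathrm{FTL}}$ attains the minimum in $$\min_{M\in\mathcal{M}^{\mathrm{OL}}}\ \max_{F\in\mathcal{F}^{\mathrm{BIS}}}\big[\mathrm{OPT}_F(F)-M(F)\big].$$
   Context: Expert learning: there are $n$ rounds and $k$ experts; the input is $v=(v_{t,j})$ with $v_{t,j}\in\{0,1\}$ the reward of expert $j$ in round $t$, so the input space is $\mathcal{V}=[\{0,1\}^k]^n$. An online algorithm $M$ outputs in each round $t$ a distribution $M_t(v)$ over experts that depends only on the history $(v_1,\dots,v_{t-1})$, where $v_s=(v_{s,1},\dots,v_{s,k})$. $\mathcal{M}^{\mathrm{OL}}$ is the class of all online algorithms. The performance of $M$ on $v$ is $M(v)=\sum_{t=1}^n\mathbf{E}_{j\sim M_t(v)}[v_{t,j}]$, and $M(F)=\mathbf{E}_{v\sim F}[M(v)]$. A distribution $F\in\mathcal{F}^{\mathrm{BIS}}$ is given by means $f_1,\dots,f_k\in[0,1]$: all rewards $v_{t,j}$ are independent and $v_{t,j}$ is Bernoulli with mean $f_j$ for every round $t$; $\mathcal{F}^{\mathrm{BIS}}$ contains all choices of means. $\mathrm{OPT}_F=\arg\max_{M\in\mathcal{M}^{\mathrm{OL}}}M(F)$, so $\mathrm{OPT}_F(F)=n\max_j f_j$. Follow-the-leader selects in round $t$ an expert uniformly at random from the set $\arg\max_j\sum_{t'<t}v_{t',j}$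 of experts with highest total reward in previous rounds (all experts in round 1). *)

theory Defs
  imports "HOL-Probability.Probability"
begin

text \<open>
  Experts are \<open>1, \<dots>, k\<close> and rounds are \<open>1, \<dots>, n\<close>. An input \<open>v\<close> assigns a binary reward to each
  pair (round, expert), with \<open>True\<close> standing for reward 1 and \<open>False\<close> for reward 0. Entries outside
  \<open>{1..n} \<times> {1..k}\<close> carry no information: they are fixed to \<open>False\<close> by the distributions and are
  ignored by online algorithms.
\<close>

type_synonym input = "nat \<times> nat \<Rightarrow> bool"

type_synonym alg = "nat \<Rightarrow> input \<Rightarrow> nat pmf"

text \<open>The values of an algorithm outside the rounds \<open>1, \<dots>, n\<close> are unconstrained and never used.\<close>

definition online_algs :: "nat \<Rightarrow> nat \<Rightarrow> alg set" where
  "online_algs k n =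
     {M. \<forall>t\<in>{1..n}.
           (\<forall>v. set_pmf (M t v) \<subseteq> {1..k}) \<and>
           (\<forall>v v'. (\<forall>s\<in>{1..<t}. \<forall>j\<in>{1..k}. v (s, j) = v' (s, j)) \<longrightarrow> M t v = M t v')}"

definition performance :: "nat \<Rightarrow> alg \<Rightarrow> input \<Rightarrow> real" where
  "performance n M v = (\<Sum>t=1..n. measure_pmf.expectation (M t v) (\<lambda>j. of_bool (v (t, j))))"

definition expected_performance :: "nat \<Rightarrow> alg \<Rightarrow> input pmf \<Rightarrow> real" where
  "expected_performance n M F = measure_pmf.expectation F (performance n M)"

definition bis :: "nat \<Rightarrow> nat \<Rightarrow> (nat \<Rightarrow> real) \<Rightarrow> input pmf" where
  "bis k n f = Pi_pmf ({1..n} \<times> {1..k}) False (\<lambda>(t, j). bernoulli_pmf (f j))"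

definition BIS :: "nat \<Rightarrow> nat \<Rightarrow> input pmf set" where
  "BIS k n = {bis k n f | f. \<forall>j\<in>{1..k}. f j \<in> {0..1}}"

text \<open>An arbitrary maximiser. For \<open>F \<in> BIS k n\<close> with \<open>k \<ge> 1\<close> the maximum is attained by always playing an expert with the largest mean.\<close>

definition OPT :: "nat \<Rightarrow> nat \<Rightarrow> input pmf \<Rightarrow> alg" where
  "OPT k n F = (ARG_MAX (\<lambda>M. expected_performance n M F) M. M \<in> online_algs k n)"

definition regret :: "nat \<Rightarrow> nat \<Rightarrow> alg \<Rightarrow> input pmf \<Rightarrow> real" where
  "regret k n M F = expected_performance n (OPT k n F) F - expected_performance n M F"

text \<open>For an online algorithm the regrets form a nonempty set of reals contained in \<open>[0, n]\<close>, so the supremum is meaningful.\<close>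

definition worst_case_regret :: "nat \<Rightarrow> nat \<Rightarrow> alg \<Rightarrow> real" where
  "worst_case_regret k n M = (SUP F\<in>BIS k n. regret k n M F)"

definition total_reward :: "nat \<Rightarrow> input \<Rightarrow> nat \<Rightarrow> nat" where
  "total_reward t v j = (\<Sum>s\<in>{1..<t}. of_bool (v (s, j)))"

definition FTL :: "nat \<Rightarrow> alg" where
  "FTL k t v = pmf_of_set {j. is_arg_max (total_reward t v) (\<lambda>i. i \<in> {1..k}) j}"

end

theory Submission
  imports Defs "HOL-Combinatorics.Permutations"
begin

text \<open>
  In round \<open>t\<close> the rewards are independent of the history, so only the conditional mean of the expert
  that is played matters. If the means are assigned to the experts by a uniformly random permutation,
  then the likelihood ratio is monotone, and an expert with the largest past reward has the largest
  posterior mean. Hence FTL is Bayes optimal for every permutation prior. As the performance of FTL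
  does not depend on the labelling of the experts and the optimum is \<open>n * Max f\<close>, the regret of FTL
  at means \<open>f\<close> is its average over the permutations of \<open>f\<close>, which is at most the average, hence at
  most the worst case, of any other algorithm. The worst case is attained because the regret is
  continuous on the compact cube of means.
\<close>

section \<open>Finite inputs and their likelihood\<close>

definition inputs :: "nat \<Rightarrow> nat \<Rightarrow> input set" where
  "inputs k m = PiE_dflt ({1..m} \<times> {1..k}) False (\<lambda>_. UNIV)"

text \<open>Closed form of the probability of \<open>v\<close> after \<open>m\<close> rounds, in
  which \<open>v\<close> enters only through its total rewards. Since \<open>total_reward t\<close>
  counts the rounds before \<open>t\<close>, the index \<open>Suc m\<close> covers all
  \<open>m\<close> rounds.\<close>

definition likelihood :: "nat \<Rightarrow> nat \<Rightarrow> (nat \<Rightarrow> real) \<Rightarrow> input \<Rightarrow> real" where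
  "likelihood k m f v =
     (\<Prod>j\<in>{1..k}. f j ^ total_reward (Suc m) v j * (1 - f j) ^ (m - total_reward (Suc m) v j))"

lemma finite_inputs [simp]: "finite (inputs k m)"
  by (auto simp: inputs_def)

lemma total_reward_Suc: "total_reward (Suc m) v j = card {s\<in>{1..m}. v (s, j)}"
proof -
  have "{1..<Suc m} = {1..m}" by auto
  then show ?thesis by (simp add: total_reward_def sum.If_cases of_bool_def Int_def)
qed

lemma total_reward_le: "total_reward (Suc m) v j \<le> m"
  unfolding total_reward_Suc by (rule order.trans[OF card_mono[of "{1..m}"]]) auto

lemma prod_bernoulli_column:
  fixes p :: real
  shows "(\<Prod>s\<in>{1..m}. if v (s, j) then p else 1 - p) =
    p ^ total_reward (Suc m) v j * (1 - p) ^ (m - total_reward (Suc m) v j)"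
proof -
  let ?A = "{s\<in>{1..m}. v (s, j)}"
  have sets: "{1..m} \<inter> {s. v (s, j)} = ?A" "{1..m} \<inter> - {s. v (s, j)} = {1..m} - ?A"
    by auto
  have "card ({1..m} - ?A) = m - card ?A"
    by (subst card_Diff_subset) auto
  moreover have "(\<Prod>s\<in>{1..m}. if v (s, j) then p else 1 - p) = p ^ card ?A * (1 - p) ^ card ({1..m} - ?A)"
    by (subst prod.If_cases) (simp_all only: finite_atLeastAtMost prod_constant sets)
  ultimately show ?thesis
    by (simp only: total_reward_Suc)
qed

lemma pmf_bis:
  assumes f: "\<forall>j\<in>{1..k}. f j \<in> {0..1}" and v: "v \<in> inputs k m"
  shows "pmf (bis k m f) v = likelihood k m f v"
proof -
  have "pmf (bis k m f) v = (\<Prod>x\<in>{1..m} \<times> {1..k}. pmf (case x of (t, j) \<Rightarrow> bernoulli_pmf (f j)) (v x))"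
    unfolding bis_def
  proof (rule pmf_Pi')
    show "v x = False" if "x \<notin> {1..m} \<times> {1..k}" for x
      using v that unfolding inputs_def PiE_dflt_def by blast
  qed simp
  also have "\<dots> = (\<Prod>(t, j)\<in>{1..m} \<times> {1..k}. if v (t, j) then f j else 1 - f j)"
    using f by (intro prod.cong) auto
  also have "\<dots> = (\<Prod>j\<in>{1..k}. \<Prod>t\<in>{1..m}. if v (t, j) then f j else 1 - f j)"
    by (subst prod.swap) (rule prod.cartesian_product[symmetric])
  finally show ?thesis
    unfolding likelihood_def prod_bernoulli_column .
qed

lemma set_pmf_bis: "set_pmf (bis k m f) \<subseteq> inputs k m"
  unfolding bis_def inputs_def by (subst set_Pi_pmf) (auto simp: PiE_dflt_def)

lemma integrable_bis [simp]: "integrable (measure_pmf (bis k m f)) (g :: input \<Rightarrow> real)"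
  by (intro integrable_measure_pmf_finite finite_subset[OF set_pmf_bis]) simp

lemma expectation_bis:
  assumes "\<forall>j\<in>{1..k}. f j \<in> {0..1}"
  shows "measure_pmf.expectation (bis k m f) g = (\<Sum>v\<in>inputs k m. likelihood k m f v * g v)"
  using set_pmf_bis[of k m f] pmf_bis[OF assms]
  by (subst integral_measure_pmf_real[of "inputs k m"]) (auto intro!: sum.cong)

section \<open>Expected performance as a sum over histories\<close>

lemma expectation_pair_mult:
  fixes g :: "'a \<Rightarrow> real" and h :: "'b \<Rightarrow> real"
  assumes "finite (set_pmf p)" "finite (set_pmf q)"
  shows "measure_pmf.expectation (pair_pmf p q) (\<lambda>(x, y). g x * h y) =
    measure_pmf.expectation p g * measure_pmf.expectation q h"
proof -
  have "measure_pmf.expectation (pair_pmf p q) (\<lambda>(x, y). g x * h y) =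
      (\<Sum>(x, y)\<in>set_pmf p \<times> set_pmf q. (g x * pmf p x) * (h y * pmf q y))"
    using assms by (subst integral_measure_pmf_real[where A = "set_pmf p \<times> set_pmf q"])
      (auto intro!: sum.cong simp: pmf_pair)
  also have "\<dots> = (\<Sum>x\<in>set_pmf p. g x * pmf p x) * (\<Sum>y\<in>set_pmf q. h y * pmf q y)"
    by (simp only: sum_product sum.cartesian_product)
  finally show ?thesis
    using assms by (simp add: integral_measure_pmf_real)
qed

text \<open>\<open>g\<close> sees only rounds before \<open>t\<close>, so it is independent of the
  entry \<open>(t, j)\<close>. The expectation factors, and for \<open>g\<close> only the marginal
  of the first \<open>t - 1\<close> rounds remains.\<close>

lemma expectation_round:
  fixes g :: "input \<Rightarrow> real"
  assumes f: "\<forall>j\<in>{1..k}. f j \<in> {0..1}" and t: "t \<in> {1..n}" and j: "j \<in> {1..k}"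
    and g: "\<And>v v'. \<forall>s\<in>{1..<t}. \<forall>j\<in>{1..k}. v (s, j) = v' (s, j) \<Longrightarrow> g v = g v'"
  shows "measure_pmf.expectation (bis k n f) (\<lambda>v. g v * of_bool (v (t, j))) =
    f j * measure_pmf.expectation (bis k (t - 1) f) g"
proof -
  define I where "I = {1..n} \<times> {1..k} - {(t, j)}"
  define H where "H = {1..t - 1} \<times> {1..k}"
  define p where "p = (\<lambda>(t::nat, j). bernoulli_pmf (f j))"
  have fin: "finite I" and HI: "H \<subseteq> I" using t by (auto simp: I_def H_def)
  have "insert (t, j) I = {1..n} \<times> {1..k}" using t j by (auto simp: I_def)
  then have "bis k n f = Pi_pmf (insert (t, j) I) False p"
    by (simp add: bis_def p_def)
  also have "\<dots> = map_pmf (\<lambda>(y, v). v((t, j) := y)) (pair_pmf (bernoulli_pmf (f j)) (Pi_pmf I False p))"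
    using fin by (subst Pi_pmf_insert) (auto simp: p_def I_def)
  finally have "measure_pmf.expectation (bis k n f) (\<lambda>v. g v * of_bool (v (t, j))) =
      measure_pmf.expectation (pair_pmf (bernoulli_pmf (f j)) (Pi_pmf I False p))
        (\<lambda>(y, v). g (v((t, j) := y)) * of_bool y)"
    by (simp add: case_prod_unfold)
  \<comment> \<open>Overwriting the entry \<open>(t, j)\<close> leaves the history before
    \<open>t\<close>, hence \<open>g\<close>, unchanged.\<close>
  also have "(\<lambda>(y, v). g (v((t, j) := y)) * of_bool y) = (\<lambda>(y, v). of_bool y * g v)"
    by (auto intro!: g simp: fun_eq_iff)
  also have "measure_pmf.expectation (pair_pmf (bernoulli_pmf (f j)) (Pi_pmf I False p)) \<dots> =
      f j * measure_pmf.expectation (Pi_pmf I False p) g"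
    using fin f j by (subst expectation_pair_mult)
      (auto simp: set_Pi_pmf)
  \<comment> \<open>Resetting entries outside the history to the default \<open>False\<close> is
    also invisible to \<open>g\<close>; this is the restriction map of
    \<open>Pi_pmf_subset\<close>.\<close>
  also have "measure_pmf.expectation (Pi_pmf I False p) g =
      measure_pmf.expectation (Pi_pmf I False p) (\<lambda>v. g (\<lambda>x. if x \<in> H then v x else False))"
    by (intro Bochner_Integration.integral_cong refl g) (auto simp: H_def)
  also have "\<dots> = measure_pmf.expectation (bis k (t - 1) f) g"
    unfolding bis_def p_def[symmetric] H_def[symmetric]
    by (subst Pi_pmf_subset[OF fin HI]) simp
  finally show ?thesis .
qed

text \<open>By independence each reward of round \<open>t\<close> may be replaced by its mean. The
  resulting formula is polynomial in the means, which serves both the exchange argument and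
  continuity.\<close>

lemma expected_performance_bis:
  assumes f: "\<forall>j\<in>{1..k}. f j \<in> {0..1}" and M: "M \<in> online_algs k n"
  shows "expected_performance n M (bis k n f) = (\<Sum>t=1..n. \<Sum>v\<in>inputs k (t - 1).
    likelihood k (t - 1) f v * (\<Sum>j\<in>{1..k}. f j * pmf (M t v) j))"
proof -
  have sub: "set_pmf (M t v) \<subseteq> {1..k}" if "t \<in> {1..n}" for t v
    using M that by (auto simp: online_algs_def)
  have hist: "M t v = M t v'" if "t \<in> {1..n}" "\<forall>s\<in>{1..<t}. \<forall>j\<in>{1..k}. v (s, j) = v' (s, j)" for t v v'
    using M that unfolding online_algs_def by blast
  have "performance n M v = (\<Sum>t=1..n. \<Sum>j\<in>{1..k}. pmf (M t v) j * of_bool (v (t, j)))" for v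
    unfolding performance_def
  proof (intro sum.cong refl)
    fix t assume "t \<in> {1..n}"
    then show "measure_pmf.expectation (M t v) (\<lambda>j. of_bool (v (t, j))) =
        (\<Sum>j\<in>{1..k}. pmf (M t v) j * of_bool (v (t, j)))"
      by (subst integral_measure_pmf_real[where A = "{1..k}"]) (use sub in \<open>blast | simp add: mult.commute\<close>)+
  qed
  then have perf: "performance n M =
      (\<lambda>v. \<Sum>t=1..n. \<Sum>j\<in>{1..k}. pmf (M t v) j * of_bool (v (t, j)))" by blast
  have "expected_performance n M (bis k n f) =
      (\<Sum>t=1..n. \<Sum>j\<in>{1..k}. measure_pmf.expectation (bis k n f) (\<lambda>v. pmf (M t v) j * of_bool (v (t, j))))"
    unfolding expected_performance_def perf by (simp only: Bochner_Integration.integral_sum integrable_bis)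
  also have "\<dots> = (\<Sum>t=1..n. \<Sum>j\<in>{1..k}. f j * measure_pmf.expectation (bis k (t - 1) f) (\<lambda>v. pmf (M t v) j))"
  proof (intro sum.cong refl expectation_round f)
    fix t j and v v' :: input
    assume "t \<in> {1..n}" "\<forall>s\<in>{1..<t}. \<forall>j\<in>{1..k}. v (s, j) = v' (s, j)"
    then show "pmf (M t v) j = pmf (M t v') j" using hist by metis
  qed
  also have "\<dots> = (\<Sum>t=1..n. measure_pmf.expectation (bis k (t - 1) f) (\<lambda>v. \<Sum>j\<in>{1..k}. f j * pmf (M t v) j))"
    by (simp add: Bochner_Integration.integral_sum)
  finally show ?thesis
    by (simp add: expectation_bis[OF f])
qed

section \<open>The value of the optimum\<close>

lemma sum_mult_pmf_le:
  fixes c :: "'a \<Rightarrow> real"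
  assumes "set_pmf p \<subseteq> A" "finite A" "\<And>x. x \<in> A \<Longrightarrow> c x \<le> b"
  shows "(\<Sum>x\<in>A. c x * pmf p x) \<le> b"
proof -
  have "(\<Sum>x\<in>A. c x * pmf p x) \<le> (\<Sum>x\<in>A. b * pmf p x)"
    using assms by (intro sum_mono mult_right_mono) auto
  also have "\<dots> = b" using assms by (simp add: sum_distrib_left[symmetric] sum_pmf_eq_1)
  finally show ?thesis .
qed

lemma likelihood_nonneg:
  "\<forall>j\<in>{1..k}. f j \<in> {0..1} \<Longrightarrow> 0 \<le> likelihood k m f v"
  by (auto simp: likelihood_def intro!: prod_nonneg)

lemma sum_likelihood:
  assumes "\<forall>j\<in>{1..k}. f j \<in> {0..1}"
  shows "(\<Sum>v\<in>inputs k m. likelihood k m f v) = 1"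
  using expectation_bis[OF assms, of m "\<lambda>_. 1"] by simp

lemma constant_alg_online: "j \<in> {1..k} \<Longrightarrow> (\<lambda>_ _. return_pmf j) \<in> online_algs k n"
  by (simp add: online_algs_def)

lemma expected_performance_constant:
  assumes f: "\<forall>j\<in>{1..k}. f j \<in> {0..1}" and j: "j \<in> {1..k}"
  shows "expected_performance n (\<lambda>_ _. return_pmf j) (bis k n f) = n * f j"
proof -
  have "(\<Sum>i\<in>{1..k}. f i * pmf (return_pmf j) i) = f j"
    using j by (subst sum.remove[of _ j]) (auto simp: indicator_def intro!: sum.neutral)
  then show ?thesis
    by (simp add: expected_performance_bis[OF f constant_alg_online[OF j]]
        sum_distrib_right[symmetric] sum_likelihood[OF f])
qed

lemma expected_performance_le:
  assumes f: "\<forall>j\<in>{1..k}. f j \<in> {0..1}" and M: "M \<in> online_algs k n"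
  shows "expected_performance n M (bis k n f) \<le> n * Max (f ` {1..k})"
proof -
  have "expected_performance n M (bis k n f) \<le>
      (\<Sum>t=1..n. \<Sum>v\<in>inputs k (t - 1). likelihood k (t - 1) f v * Max (f ` {1..k}))"
    unfolding expected_performance_bis[OF f M] using f M
    by (intro sum_mono mult_left_mono sum_mult_pmf_le likelihood_nonneg)
      (auto simp: online_algs_def)
  then show ?thesis
    by (simp add: sum_distrib_right[symmetric] sum_likelihood[OF f])
qed

text \<open>\<open>OPT\<close> is a choice operator and is informative only once some maximiser
  exists. Always playing an expert of largest mean is one, as it meets the bound of
  \<open>expected_performance_le\<close>.\<close>

lemma expected_performance_OPT:
  assumes f: "\<forall>j\<in>{1..k}. f j \<in> {0..1}" and k: "k \<ge> 1"
  shows "expected_performance n (OPT k n (bis k n f)) (bis k n f) = n * Max (f ` {1..k})"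
proof -
  let ?E = "\<lambda>M. expected_performance n M (bis k n f)"
  have "Max (f ` {1..k}) \<in> f ` {1..k}" using k by (intro Max_in) auto
  then obtain j where j: "j \<in> {1..k}" "Max (f ` {1..k}) = f j" by blast
  let ?C = "\<lambda>_ _. return_pmf j"
  have C: "?E ?C = n * Max (f ` {1..k})"
    using expected_performance_constant[OF f j(1)] j(2) by simp
  have "is_arg_max ?E (\<lambda>M. M \<in> online_algs k n) ?C"
    using constant_alg_online[OF j(1)] expected_performance_le[OF f]
    by (simp add: is_arg_max_linorder C)
  then have OPT: "is_arg_max ?E (\<lambda>M. M \<in> online_algs k n) (OPT k n (bis k n f))"
    unfolding OPT_def arg_max_def by (rule someI[where P = "is_arg_max ?E (\<lambda>M. M \<in> online_algs k n)"])
  show ?thesis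
  proof (rule order.antisym)
    show "?E (OPT k n (bis k n f)) \<le> n * Max (f ` {1..k})"
      using OPT by (intro expected_performance_le[OF f]) (simp add: is_arg_max_def)
    show "n * Max (f ` {1..k}) \<le> ?E (OPT k n (bis k n f))"
      using OPT constant_alg_online[OF j(1)] unfolding is_arg_max_linorder C[symmetric] by blast
  qed
qed

lemma regret_bis:
  assumes "\<forall>j\<in>{1..k}. f j \<in> {0..1}" "k \<ge> 1"
  shows "regret k n M (bis k n f) = n * Max (f ` {1..k}) - expected_performance n M (bis k n f)"
  using expected_performance_OPT[OF assms] by (simp add: regret_def)

section \<open>Bayes optimality of FTL under permuted means\<close>

text \<open>Pulling out the common nonnegative factor leaves
  \<open>p ^ (s - r) - q ^ (s - r)\<close> with \<open>p = a * (1 - b)\<close> and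
  \<open>q = b * (1 - a)\<close>. As \<open>p - q = a - b\<close>, this cannot have the sign
  opposite to \<open>a - b\<close>.\<close>

lemma exchange_inequality:
  fixes a b :: real
  assumes ab: "a \<in> {0..1}" "b \<in> {0..1}" and r: "r \<le> s" "s \<le> m"
  shows "0 \<le> (a - b) * (a ^ s * (1 - a) ^ (m - s) * (b ^ r * (1 - b) ^ (m - r)) -
    b ^ s * (1 - b) ^ (m - s) * (a ^ r * (1 - a) ^ (m - r)))"
proof -
  let ?C = "(a * b) ^ r * ((1 - a) * (1 - b)) ^ (m - s)"
  let ?p = "a * (1 - b)" and ?q = "b * (1 - a)"
  have s: "x ^ s = x ^ r * x ^ (s - r)" "x ^ (m - r) = x ^ (m - s) * x ^ (s - r)" for x :: real
    using r by (simp_all flip: power_add)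
  have eq: "a ^ s * (1 - a) ^ (m - s) * (b ^ r * (1 - b) ^ (m - r)) -
      b ^ s * (1 - b) ^ (m - s) * (a ^ r * (1 - a) ^ (m - r)) = ?C * (?p ^ (s - r) - ?q ^ (s - r))"
    unfolding s power_mult_distrib by algebra
  have C: "0 \<le> ?C" using ab by simp
  have "0 \<le> (a - b) * (?p ^ (s - r) - ?q ^ (s - r))"
  proof (cases "b \<le> a")
    case True
    then have "?q ^ (s - r) \<le> ?p ^ (s - r)"
      using ab by (intro power_mono mult_mono) auto
    then show ?thesis using True by simp
  next
    case False
    then have "?p ^ (s - r) \<le> ?q ^ (s - r)"
      using ab by (intro power_mono mult_mono) auto
    then show ?thesis using False by (simp add: mult_nonpos_nonpos)
  qed
  then have "0 \<le> ?C * ((a - b) * (?p ^ (s - r) - ?q ^ (s - r)))"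
    using C by (rule mult_nonneg_nonneg[rotated])
  then show ?thesis unfolding eq by (simp only: mult.left_commute)
qed

text \<open>The likelihood ratio of two experts is monotone in the difference of their total rewards:
  exchanging the means of \<open>i\<close> and \<open>j\<close> moves likelihood towards giving the leader the larger mean.\<close>

lemma likelihood_exchange:
  assumes f: "\<forall>j\<in>{1..k}. f j \<in> {0..1}" and i: "i \<in> {1..k}" and j: "j \<in> {1..k}"
    and le: "total_reward (Suc m) v j \<le> total_reward (Suc m) v i"
  shows "0 \<le> (f i - f j) * (likelihood k m f v - likelihood k m (f \<circ> Transposition.transpose i j) v)"
proof (cases "i = j")
  case False
  define h where "h g l = g l ^ total_reward (Suc m) v l * (1 - g l) ^ (m - total_reward (Suc m) v l)"
    for g :: "nat \<Rightarrow> real" and l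
  define C where "C = (\<Prod>l\<in>{1..k} - {i, j}. h f l)"
  have split: "likelihood k m g v = h g i * h g j * (\<Prod>l\<in>{1..k} - {i, j}. h g l)" for g
  proof -
    have "{1..k} = insert i (insert j ({1..k} - {i, j}))" using i j by auto
    then have "likelihood k m g v = prod (h g) (insert i (insert j ({1..k} - {i, j})))"
      unfolding likelihood_def h_def by (rule prod.cong) (rule refl)
    then show ?thesis using False by simp
  qed
  \<comment> \<open>The transposition fixes all other experts, so their factors cancel into the
    common \<open>C\<close>.\<close>
  have C': "(\<Prod>l\<in>{1..k} - {i, j}. h (f \<circ> Transposition.transpose i j) l) = C"
    unfolding C_def by (rule prod.cong) (auto simp: h_def Transposition.transpose_def)
  have eq: "(f i - f j) * (likelihood k m f v - likelihood k m (f \<circ> Transposition.transpose i j) v) =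
      C * ((f i - f j) * (h f i * h f j -
        h (f \<circ> Transposition.transpose i j) i * h (f \<circ> Transposition.transpose i j) j))"
    unfolding split C' C_def[symmetric] by (simp add: algebra_simps)
  have "0 \<le> C"
    unfolding C_def h_def using f by (intro prod_nonneg) auto
  moreover have "0 \<le> (f i - f j) * (h f i * h f j -
        h (f \<circ> Transposition.transpose i j) i * h (f \<circ> Transposition.transpose i j) j)"
    using exchange_inequality[of "f i" "f j", OF _ _ le total_reward_le] f i j
    by (simp add: h_def mult_ac)
  ultimately show ?thesis unfolding eq by (rule mult_nonneg_nonneg)
qed simp

lemma means_permute:
  assumes "\<forall>j\<in>{1..k}. f j \<in> {0..1::real}" "\<pi> permutes {1..k}"
  shows "\<forall>j\<in>{1..k}. (f \<circ> \<pi>) j \<in> {0..1}"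
  using assms permutes_in_image by fastforce

text \<open>Up to normalisation, the posterior mean of expert \<open>j\<close> when the means are assigned to the
  experts by a uniformly random permutation.\<close>

definition posterior :: "nat \<Rightarrow> nat \<Rightarrow> (nat \<Rightarrow> real) \<Rightarrow> input \<Rightarrow> nat \<Rightarrow> real" where
  "posterior k m f v j = (\<Sum>\<pi> | \<pi> permutes {1..k}. f (\<pi> j) * likelihood k m (f \<circ> \<pi>) v)"

text \<open>Pairing each permutation with its composition with the transposition of \<open>i\<close>
  and \<open>j\<close> turns twice the difference into a sum of the products that
  \<open>likelihood_exchange\<close> shows nonnegative.\<close>

lemma posterior_mono:
  assumes f: "\<forall>j\<in>{1..k}. f j \<in> {0..1}" and i: "i \<in> {1..k}" and j: "j \<in> {1..k}"
    and le: "total_reward (Suc m) v j \<le> total_reward (Suc m) v i"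
  shows "posterior k m f v j \<le> posterior k m f v i"
proof -
  let ?\<tau> = "Transposition.transpose i j"
  have \<tau>: "?\<tau> permutes {1..k}" using i j by (rule permutes_swap_id)
  have re: "posterior k m f v l =
      (\<Sum>\<pi> | \<pi> permutes {1..k}. f (\<pi> (?\<tau> l)) * likelihood k m (f \<circ> \<pi> \<circ> ?\<tau>) v)" for l
    unfolding posterior_def by (subst sum_permutations_compose_right[OF \<tau>]) (simp add: o_assoc)
  \<comment> \<open>One copy of the difference is kept and the other is reindexed by
    \<open>re\<close>, so that the two can be added termwise.\<close>
  have "2 * (posterior k m f v i - posterior k m f v j) =
      (posterior k m f v i - posterior k m f v j) +
      ((\<Sum>\<pi> | \<pi> permutes {1..k}. f (\<pi> (?\<tau> i)) * likelihood k m (f \<circ> \<pi> \<circ> ?\<tau>) v) -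
       (\<Sum>\<pi> | \<pi> permutes {1..k}. f (\<pi> (?\<tau> j)) * likelihood k m (f \<circ> \<pi> \<circ> ?\<tau>) v))"
    unfolding re[symmetric] by simp
  also have "\<dots> = (\<Sum>\<pi> | \<pi> permutes {1..k}.
      ((f \<circ> \<pi>) i - (f \<circ> \<pi>) j) * (likelihood k m (f \<circ> \<pi>) v - likelihood k m (f \<circ> \<pi> \<circ> ?\<tau>) v))"
    unfolding posterior_def sum_subtractf[symmetric] sum.distrib[symmetric]
    by (rule sum.cong) (simp_all add: algebra_simps)
  also have "\<dots> \<ge> 0"
    using means_permute[OF f] by (intro sum_nonneg likelihood_exchange i j le) auto
  finally show ?thesis by simp
qed

section \<open>Leaders and FTL\<close>

definition leaders :: "nat \<Rightarrow> nat \<Rightarrow> input \<Rightarrow> nat set" where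
  "leaders k t v = {j. is_arg_max (total_reward t v) (\<lambda>i. i \<in> {1..k}) j}"

lemma leaders_iff:
  "j \<in> leaders k t v \<longleftrightarrow> j \<in> {1..k} \<and> (\<forall>i\<in>{1..k}. total_reward t v i \<le> total_reward t v j)"
  by (auto simp: leaders_def is_arg_max_linorder)

lemma leaders_subset: "leaders k t v \<subseteq> {1..k}"
  by (auto simp: leaders_iff)

lemma finite_leaders [simp]: "finite (leaders k t v)"
  using leaders_subset finite_atLeastAtMost by (rule finite_subset)

lemma leaders_nonempty:
  assumes "k \<ge> 1"
  shows "leaders k t v \<noteq> {}"
proof -
  have "Max (total_reward t v ` {1..k}) \<in> total_reward t v ` {1..k}"
    using assms by (intro Max_in) auto
  then obtain j where "j \<in> {1..k}" "total_reward t v j = Max (total_reward t v ` {1..k})"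
    by (metis imageE)
  then have "j \<in> leaders k t v" by (simp add: leaders_iff)
  then show ?thesis by blast
qed

lemma FTL_eq: "FTL k t v = pmf_of_set (leaders k t v)"
  by (simp add: FTL_def leaders_def)

lemma set_pmf_FTL: "k \<ge> 1 \<Longrightarrow> set_pmf (FTL k t v) = leaders k t v"
  by (simp add: FTL_eq leaders_nonempty)

lemma FTL_online:
  assumes "k \<ge> 1"
  shows "FTL k \<in> online_algs k n"
proof -
  have "FTL k t v = FTL k t v'"
    if "\<forall>s\<in>{1..<t}. \<forall>j\<in>{1..k}. v (s, j) = v' (s, j)" for t v v'
  proof -
    have "total_reward t v j = total_reward t v' j" if "j \<in> {1..k}" for j
      using \<open>\<forall>s\<in>{1..<t}. _\<close> that by (simp add: total_reward_def)
    then have "leaders k t v = leaders k t v'"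
      by (auto simp: leaders_iff simp del: atLeastAtMost_iff)
    then show ?thesis by (simp add: FTL_eq)
  qed
  then show ?thesis
    using set_pmf_FTL[OF assms] leaders_subset by (auto simp: online_algs_def simp del: One_nat_def)
qed

text \<open>A mixture over experts cannot beat the largest posterior value. Leaders attain it, and
  FTL puts all its mass on leaders.\<close>

lemma posterior_FTL_ge:
  assumes f: "\<forall>j\<in>{1..k}. f j \<in> {0..1}" and k: "k \<ge> 1" and p: "set_pmf p \<subseteq> {1..k}"
  shows "(\<Sum>j\<in>{1..k}. posterior k m f v j * pmf p j) \<le>
    (\<Sum>j\<in>{1..k}. posterior k m f v j * pmf (FTL k (Suc m) v) j)"
proof -
  obtain l where l: "l \<in> leaders k (Suc m) v"
    using leaders_nonempty[OF k] by blast
  have "(\<Sum>j\<in>{1..k}. posterior k m f v j * pmf p j) \<le> posterior k m f v l"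
    using l p by (intro sum_mult_pmf_le posterior_mono[OF f]) (auto simp: leaders_iff)
  also have "\<dots> = (\<Sum>j\<in>{1..k}. posterior k m f v l * pmf (FTL k (Suc m) v) j)"
    using set_pmf_FTL[OF k] leaders_subset
    by (simp add: sum_distrib_left[symmetric] sum_pmf_eq_1)
  also have "\<dots> = (\<Sum>j\<in>{1..k}. posterior k m f v j * pmf (FTL k (Suc m) v) j)"
  proof (rule sum.cong[OF refl])
    fix j assume j: "j \<in> {1..k}"
    show "posterior k m f v l * pmf (FTL k (Suc m) v) j = posterior k m f v j * pmf (FTL k (Suc m) v) j"
    proof (cases "j \<in> leaders k (Suc m) v")
      case True
      \<comment> \<open>Two leaders have equal total rewards, so monotonicity applies in both
        directions.\<close>
      then have "posterior k m f v l = posterior k m f v j"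
        using l by (intro order.antisym posterior_mono[OF f]) (auto simp: leaders_iff)
      then show ?thesis by simp
    next
      case False
      then show ?thesis using set_pmf_FTL[OF k] by (simp add: pmf_eq_0_set_pmf)
    qed
  qed
  finally show ?thesis .
qed

text \<open>Moving the sum over permutations innermost collects the posterior of each history, so
  the choices of \<open>M\<close> at different histories can be compared separately.\<close>

lemma sum_expected_performance_permuted:
  assumes f: "\<forall>j\<in>{1..k}. f j \<in> {0..1}" and M: "M \<in> online_algs k n"
  shows "(\<Sum>\<pi> | \<pi> permutes {1..k}. expected_performance n M (bis k n (f \<circ> \<pi>))) =
    (\<Sum>t=1..n. \<Sum>v\<in>inputs k (t - 1). \<Sum>j\<in>{1..k}. posterior k (t - 1) f v j * pmf (M t v) j)"
proof -
  let ?P = "{\<pi>. \<pi> permutes {1..k}}"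
  have "(\<Sum>\<pi>\<in>?P. expected_performance n M (bis k n (f \<circ> \<pi>))) =
      (\<Sum>\<pi>\<in>?P. \<Sum>t=1..n. \<Sum>v\<in>inputs k (t - 1). \<Sum>j\<in>{1..k}.
        f (\<pi> j) * likelihood k (t - 1) (f \<circ> \<pi>) v * pmf (M t v) j)"
    by (intro sum.cong refl, subst expected_performance_bis[OF means_permute[OF f] M])
      (simp_all add: sum_distrib_left mult_ac)
  also have "\<dots> = (\<Sum>t=1..n. \<Sum>v\<in>inputs k (t - 1). \<Sum>j\<in>{1..k}. \<Sum>\<pi>\<in>?P.
        f (\<pi> j) * likelihood k (t - 1) (f \<circ> \<pi>) v * pmf (M t v) j)"
    by (simp only: sum.swap[of _ _ ?P])
  finally show ?thesis
    by (simp only: posterior_def sum_distrib_right)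
qed

lemma FTL_permuted_ge:
  assumes f: "\<forall>j\<in>{1..k}. f j \<in> {0..1}" and k: "k \<ge> 1" and M: "M \<in> online_algs k n"
  shows "(\<Sum>\<pi> | \<pi> permutes {1..k}. expected_performance n M (bis k n (f \<circ> \<pi>))) \<le>
    (\<Sum>\<pi> | \<pi> permutes {1..k}. expected_performance n (FTL k) (bis k n (f \<circ> \<pi>)))"
  unfolding sum_expected_performance_permuted[OF f M]
    sum_expected_performance_permuted[OF f FTL_online[OF k]]
proof (rule sum_mono, rule sum_mono)
  fix t v assume t: "t \<in> {1..n}"
  then have "set_pmf (M t v) \<subseteq> {1..k}" using M by (auto simp: online_algs_def)
  \<comment> \<open>Here \<open>t \<ge> 1\<close>, so \<open>Suc (t - 1)\<close> is
    \<open>t\<close>.\<close>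
  from posterior_FTL_ge[OF f k this, of "t - 1" v] t
  show "(\<Sum>j\<in>{1..k}. posterior k (t - 1) f v j * pmf (M t v) j) \<le>
    (\<Sum>j\<in>{1..k}. posterior k (t - 1) f v j * pmf (FTL k t v) j)" by simp
qed

section \<open>Symmetry of FTL under relabelling of experts\<close>

text \<open>Expert \<open>j\<close> receives the rewards of expert \<open>\<pi> j\<close>, matching
  the means \<open>f \<circ> \<pi>\<close>.\<close>

definition relabel :: "(nat \<Rightarrow> nat) \<Rightarrow> input \<Rightarrow> input" where
  "relabel \<pi> v = (\<lambda>(t, j). v (t, \<pi> j))"

lemma total_reward_relabel: "total_reward t (relabel \<pi> v) j = total_reward t v (\<pi> j)"
  by (simp add: total_reward_def relabel_def)

lemma relabel_inputs:
  assumes "\<pi> permutes {1..k}" "v \<in> inputs k m"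
  shows "relabel \<pi> v \<in> inputs k m"
  using assms(2) permutes_in_image[OF assms(1)]
  by (auto simp: inputs_def PiE_dflt_def relabel_def simp del: atLeastAtMost_iff)

lemma bij_betw_relabel:
  assumes "\<pi> permutes {1..k}"
  shows "bij_betw (relabel \<pi>) (inputs k m) (inputs k m)"
  by (rule bij_betw_byWitness[where f' = "relabel (inv \<pi>)"])
    (auto simp: relabel_inputs[OF assms] relabel_inputs[OF permutes_inv[OF assms]],
     auto simp: relabel_def permutes_inverses[OF assms] fun_eq_iff)

lemma likelihood_relabel:
  assumes "\<pi> permutes {1..k}"
  shows "likelihood k m (f \<circ> \<pi>) (relabel \<pi> v) = likelihood k m f v"
  unfolding likelihood_def total_reward_relabel
  by (subst (2) prod.permute[OF assms]) (simp add: o_def)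

lemma leaders_relabel:
  assumes "\<pi> permutes {1..k}"
  shows "leaders k t (relabel \<pi> v) = \<pi> -` leaders k t v"
proof -
  have "(\<forall>i\<in>{1..k}. P (\<pi> i)) \<longleftrightarrow> (\<forall>i\<in>{1..k}. P i)" for P
    using permutes_image[OF assms] by (metis (no_types, lifting) image_iff)
  from this[of "\<lambda>i. total_reward t v i \<le> c" for c] show ?thesis
    using permutes_in_image[OF assms]
    by (auto simp: leaders_iff total_reward_relabel simp del: atLeastAtMost_iff)
qed

text \<open>Uniform tie-breaking makes the probability depend only on membership in the leader set
  and on its size; the bijection \<open>\<pi>\<close> preserves both.\<close>

lemma pmf_FTL_relabel:
  assumes \<pi>: "\<pi> permutes {1..k}" and k: "k \<ge> 1"
  shows "pmf (FTL k t (relabel \<pi> v)) j = pmf (FTL k t v) (\<pi> j)"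
proof -
  have "card (\<pi> -` leaders k t v) = card (leaders k t v)"
    using permutes_inj[OF \<pi>] permutes_surj[OF \<pi>] by (intro card_vimage_inj) auto
  moreover have "\<pi> -` leaders k t v \<noteq> {}" "finite (\<pi> -` leaders k t v)"
    using leaders_nonempty[OF k, of t "relabel \<pi> v"] finite_leaders[of k t "relabel \<pi> v"]
    by (simp_all add: leaders_relabel[OF \<pi>])
  ultimately show ?thesis
    using leaders_nonempty[OF k]
    by (simp add: FTL_eq leaders_relabel[OF \<pi>] indicator_def)
qed

text \<open>Two changes of variables: histories are reindexed by \<open>relabel \<pi>\<close>, then
  experts by \<open>\<pi>\<close>.\<close>

lemma expected_performance_FTL_permute:
  assumes f: "\<forall>j\<in>{1..k}. f j \<in> {0..1}" and \<pi>: "\<pi> permutes {1..k}" and k: "k \<ge> 1"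
  shows "expected_performance n (FTL k) (bis k n (f \<circ> \<pi>)) = expected_performance n (FTL k) (bis k n f)"
proof -
  have "(\<Sum>v\<in>inputs k m. likelihood k m (f \<circ> \<pi>) v * (\<Sum>j\<in>{1..k}. (f \<circ> \<pi>) j * pmf (FTL k t v) j)) =
      (\<Sum>v\<in>inputs k m. likelihood k m f v * (\<Sum>j\<in>{1..k}. f j * pmf (FTL k t v) j))" for t m
  proof -
    have "(\<Sum>v\<in>inputs k m. likelihood k m (f \<circ> \<pi>) v * (\<Sum>j\<in>{1..k}. (f \<circ> \<pi>) j * pmf (FTL k t v) j)) =
      (\<Sum>v\<in>inputs k m. likelihood k m f v * (\<Sum>j\<in>{1..k}. f (\<pi> j) * pmf (FTL k t v) (\<pi> j)))"
      by (subst sum.reindex_bij_betw[OF bij_betw_relabel[OF \<pi>], symmetric])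
        (simp add: likelihood_relabel[OF \<pi>] pmf_FTL_relabel[OF \<pi> k])
    also have "\<dots> = (\<Sum>v\<in>inputs k m. likelihood k m f v * (\<Sum>j\<in>{1..k}. f j * pmf (FTL k t v) j))"
      using sum.permute[OF \<pi>, of "\<lambda>j. f j * pmf (FTL k t v) j" for v] by (simp add: o_def)
    finally show ?thesis .
  qed
  then show ?thesis
    by (simp only: expected_performance_bis[OF f FTL_online[OF k]]
        expected_performance_bis[OF means_permute[OF f \<pi>] FTL_online[OF k]])
qed

section \<open>Attainment of the worst case\<close>

text \<open>Tychonoff's theorem, as the topology on functions is the product topology.\<close>

lemma compact_unit_cube: "compact {f :: 'a \<Rightarrow> real. \<forall>i. f i \<in> {0..1}}"
proof -
  have "compactin (product_topology (\<lambda>_. euclidean) UNIV) (PiE UNIV (\<lambda>_ :: 'a. {0..1::real}))"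
    by (simp add: compactin_PiE)
  moreover have "PiE UNIV (\<lambda>_ :: 'a. {0..1::real}) = {f. \<forall>i. f i \<in> {0..1}}"
    by (auto simp: PiE_def Pi_def)
  ultimately show ?thesis
    by (simp add: euclidean_product_topology)
qed

lemma continuous_on_Max_image:
  fixes f :: "'i \<Rightarrow> 'a::topological_space \<Rightarrow> 'b::linorder_topology"
  assumes "finite I" "I \<noteq> {}" "\<And>i. i \<in> I \<Longrightarrow> continuous_on A (f i)"
  shows "continuous_on A (\<lambda>x. Max ((\<lambda>i. f i x) ` I))"
  using assms by (induction I rule: finite_ne_induct) (auto intro!: continuous_on_max)

lemma bis_cong: "(\<And>j. j \<in> {1..k} \<Longrightarrow> f j = g j) \<Longrightarrow> bis k n f = bis k n g"
  unfolding bis_def by (intro Pi_pmf_cong) auto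

text \<open>\<open>BIS\<close> constrains only the means of experts in \<open>{1..k}\<close>.
  Setting the others to 0 keeps the distribution and makes the parameter set a compact cube.\<close>

lemma BIS_eq: "BIS k n = bis k n ` {f. \<forall>i. f i \<in> {0..1}}"
proof -
  have "bis k n f \<in> bis k n ` {f. \<forall>i. f i \<in> {0..1}}" if "\<forall>j\<in>{1..k}. f j \<in> {0..1}" for f
  proof
    show "bis k n f = bis k n (\<lambda>j. if j \<in> {1..k} then f j else 0)"
      by (rule bis_cong) simp
  qed (use that in auto)
  then show ?thesis by (auto simp: BIS_def simp del: atLeastAtMost_iff)
qed

lemma regret_attains_max:
  assumes k: "k \<ge> 1" and M: "M \<in> online_algs k n"
  shows "\<exists>F. is_arg_max (regret k n M) (\<lambda>F. F \<in> BIS k n) F"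
proof -
  let ?S = "{f :: nat \<Rightarrow> real. \<forall>i. f i \<in> {0..1}}"
  \<comment> \<open>The regret as an explicit function of the means, to which continuity rules
    apply; it agrees with \<open>regret\<close> on the cube.\<close>
  define R where "R f = n * Max ((\<lambda>j. f j) ` {1..k}) - (\<Sum>t=1..n. \<Sum>v\<in>inputs k (t - 1).
    likelihood k (t - 1) f v * (\<Sum>j\<in>{1..k}. f j * pmf (M t v) j))" for f :: "nat \<Rightarrow> real"
  have R: "regret k n M (bis k n f) = R f" if "f \<in> ?S" for f
    using that k M by (simp add: R_def regret_bis expected_performance_bis)
  have coord: "continuous_on ?S (\<lambda>f. f j)" for j
    by (rule continuous_on_subset[OF continuous_on_product_coordinates]) simp
  have "continuous_on ?S R"
    unfolding R_def likelihood_def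
    using k by (intro continuous_intros continuous_on_Max_image coord) auto
  moreover have "(\<lambda>_. 0) \<in> ?S" by simp
  ultimately obtain f where "f \<in> ?S" "\<forall>g\<in>?S. R g \<le> R f"
    using continuous_attains_sup[OF compact_unit_cube, of R] by (metis (no_types, lifting) empty_iff)
  then have "is_arg_max (regret k n M) (\<lambda>F. F \<in> BIS k n) (bis k n f)"
    by (auto simp: is_arg_max_linorder BIS_eq R simp del: atLeastAtMost_iff)
  then show ?thesis ..
qed

text \<open>A real supremum bounds its members only if the set is bounded above; the maximiser
  supplies the bound.\<close>

lemma regret_le_worst_case:
  assumes k: "k \<ge> 1" and M: "M \<in> online_algs k n" and F: "F \<in> BIS k n"
  shows "regret k n M F \<le> worst_case_regret k n M"
proof -
  from regret_attains_max[OF k M] obtain G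
    where "\<forall>F\<in>BIS k n. regret k n M F \<le> regret k n M G"
    by (auto simp: is_arg_max_linorder)
  then show ?thesis
    unfolding worst_case_regret_def by (intro cSUP_upper F bdd_aboveI2) auto
qed

text \<open>The regret of FTL is constant over the permutations of \<open>f\<close>, so it equals
  its average. Bayes optimality bounds this by the average for \<open>M\<close>, and each term of
  that average by the worst case.\<close>

lemma regret_FTL_le_worst_case:
  assumes k: "k \<ge> 1" and M: "M \<in> online_algs k n" and f: "\<forall>j\<in>{1..k}. f j \<in> {0..1}"
  shows "regret k n (FTL k) (bis k n f) \<le> worst_case_regret k n M"
proof -
  let ?P = "{\<pi>. \<pi> permutes {1..k}}"
  have P: "finite ?P" "id \<in> ?P" by (simp_all add: finite_permutations permutes_id)
  have Max: "Max ((f \<circ> \<pi>) ` {1..k}) = Max (f ` {1..k})" if "\<pi> \<in> ?P" for \<pi>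
    using that by (simp only: image_comp[symmetric] permutes_image mem_Collect_eq)
  note reg = regret_bis[OF means_permute[OF f] k]
  have "regret k n (FTL k) (bis k n (f \<circ> \<pi>)) = regret k n (FTL k) (bis k n f)" if "\<pi> \<in> ?P" for \<pi>
    using that expected_performance_FTL_permute[OF f _ k] Max[OF that]
    by (simp only: mem_Collect_eq reg regret_bis[OF f k])
  then have "card ?P * regret k n (FTL k) (bis k n f) =
      (\<Sum>\<pi>\<in>?P. regret k n (FTL k) (bis k n (f \<circ> \<pi>)))"
    by simp
  also have "\<dots> \<le> (\<Sum>\<pi>\<in>?P. regret k n M (bis k n (f \<circ> \<pi>)))"
    using FTL_permuted_ge[OF f k M] by (simp add: reg sum_subtractf del: comp_apply)
  also have "\<dots> \<le> (\<Sum>\<pi>\<in>?P. worst_case_regret k n M)"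
    using means_permute[OF f]
    by (intro sum_mono regret_le_worst_case[OF k M]) (auto simp: BIS_def simp del: atLeastAtMost_iff)
  also have "\<dots> = card ?P * worst_case_regret k n M" by simp
  finally have "card ?P * regret k n (FTL k) (bis k n f) \<le> card ?P * worst_case_regret k n M" .
  \<comment> \<open>The identity is a permutation, so the factor can be cancelled.\<close>
  moreover have "card ?P > 0" using P by (simp only: card_gt_0_iff) blast
  ultimately show ?thesis by simp
qed

text \<open>The first conjunct makes the supremum in \<open>worst_case_regret\<close> a maximum, so
  that the second is a genuine min-max statement.\<close>

theorem theorem9:
  fixes k n :: nat
  assumes "k \<ge> 1"
  shows "(\<forall>M\<in>online_algs k n. \<exists>F. is_arg_max (regret k n M) (\<lambda>F. F \<in> BIS k n) F) \<and>
         is_arg_min (worst_case_regret k n) (\<lambda>M. M \<in> online_algs k n) (FTL k)"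
proof
  show "\<forall>M\<in>online_algs k n. \<exists>F. is_arg_max (regret k n M) (\<lambda>F. F \<in> BIS k n) F"
    using regret_attains_max[OF assms] by blast
  have "worst_case_regret k n (FTL k) \<le> worst_case_regret k n M" if "M \<in> online_algs k n" for M
    unfolding worst_case_regret_def[of k n "FTL k"]
  \<comment> \<open>The supremum of an empty set of reals is unspecified, hence the nonemptiness
    goal; zero means witness it.\<close>
  proof (rule cSUP_least)
    show "BIS k n \<noteq> {}" by (auto simp: BIS_eq intro: exI[of _ "\<lambda>_. 0"])
    show "regret k n (FTL k) F \<le> worst_case_regret k n M" if "F \<in> BIS k n" for F
      using that regret_FTL_le_worst_case[OF assms \<open>M \<in> _\<close>] by (auto simp: BIS_def)
  qed
  then show "is_arg_min (worst_case_regret k n) (\<lambda>M. M \<in> online_algs k n) (FTL k)"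
    by (simp add: is_arg_min_linorder FTL_online[OF assms])
qed

end
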